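(* In the satisfaction system of preference statements with hierarchical models, there exist (a choice of variables, domains and operator $\oplus$ and) non-trivial sets of stakeholder statements $\Phi_1,\ldots,\Phi_n\subseteq\mathcal{L}$ that admit no middle ground.
   Context: Let $V$ be a finite set of variables; each $v\in V$ has a finite domain $\underline{v}$ with more than one element; alternatives are elements $\alpha\in\underline{V}=\prod_{v\in V}\underline{v}$, with $\alpha(v)$ the value of $v$. Let $\oplus$ be a commutative, associative operator combining values of any nonempty set of variables, and assume a total order $\geq$ on the domains and on $\oplus$-combinations of values. A hierarchical model is a non-empty sequence $\pi=(Y_1,\ldots,Y_k)$ of non-empty (not necessarily disjoint) subsets of $V$. For alternatives $\alpha,\beta$: $\alpha\succeq_\pi\beta$ iff either $\bigoplus_{y\in Y_i}\alpha(y)=\bigoplus_{y\in Y_i}\beta(y)$ for all $i$, or there is $i$ with $\bigoplus_{y\in Y_i}\alpha(y)>\bigoplus_{y\in Y_i}\beta(y)$ and equality for all $j<i$; $\alpha\succ_\pi\beta$ iff the second condition holds. The language is $\mathcal{L}=\{\alpha\geq\beta\mid\alpha,\beta\in\underline{V}\}\cup\{\alpha>\beta\mid\alpha,\beta\in\underline{V}\}$, with $\pi\models\alpha\geq\beta$ iff $\alpha\succeq_\pi\beta$ and $\pi\models\alpha>\beta$ iff $\alpha\succ_\pi\beta$. For $\Phi\subseteq\mathcal{L}$: $\pi\models\Phi$ iff $\pi$ satisfies every element; $\Phi\models\Phi'$ iff every model of $\Phi$ is a model of $\Phi'$; $\Phi\equiv\Phi'$ iff mutual entailment; $\Phi$ is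 consistent if it has a model, falsifiable if some hierarchical model does not satisfy it, non-trivial if both. Given non-trivial $\Phi_1,\ldots,\Phi_n$, $\Phi\subseteq\mathcal{L}$ is a middle ground if: (P1) $\Phi$ non-trivial; (P2) if $\bigcup_i\Phi_i$ is consistent then $\Phi\equiv\bigcup_i\Phi_i$; (P3) for each $\phi\in\Phi$, each $i$ and each $\phi_i\in\Phi_i$ some model satisfies both $\phi$ and $\phi_i$; (P4) each $\phi\in\Phi$ is entailed by some $\Phi_i$; (P5) no $\Phi'\subseteq\mathcal{L}$ satisfying (P1)–(P4) has $\Phi'\models\Phi$ and $\Phi\not\models\Phi'$. *)

theory Defs
  imports Complex_Main "HOL-Library.FuncSet"
begin

datatype 'x pref_stmt = Geq 'x 'x | Gt 'x 'x

text \<open>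
  The order on the domains and on the combinations of values is the one of the type class
  \<^class>\<open>linorder\<close>; the operator is total on the type of values, which contains all the
  domains and all combinations of their elements.
\<close>

locale preference_setting = abel_semigroup oplus
  for oplus :: "'a::linorder \<Rightarrow> 'a \<Rightarrow> 'a"  (infixl "\<oplus>" 65) +
  fixes V :: "'v set"
    and D :: "'v \<Rightarrow> 'a set"
  assumes finite_variables: "finite V"
    and finite_domains: "\<And>v. v \<in> V \<Longrightarrow> finite (D v)"
    and domains_gt_1: "\<And>v. v \<in> V \<Longrightarrow> card (D v) > 1"
begin

definition alternatives :: "('v \<Rightarrow> 'a) set" where
  "alternatives = (\<Pi>\<^sub>E v\<in>V. D v)"

text \<open>
  The operator need not have a neutral element, so the combination over a non-empty finite set
  is a fold that starts from \<^const>\<open>None\<close>, as in the library's \<^locale>\<open>semilattice_set\<close>.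
  It is characterised by the two lemmas that follow.
\<close>

definition combine :: "('v \<Rightarrow> 'a) \<Rightarrow> 'v set \<Rightarrow> 'a" where
  "combine \<alpha> Y =
     the (Finite_Set.fold
       (\<lambda>y c. Some (case c of None \<Rightarrow> \<alpha> y | Some z \<Rightarrow> \<alpha> y \<oplus> z)) None Y)"

lemma combine_fold_commute:
  "comp_fun_commute (\<lambda>y c. Some (case c of None \<Rightarrow> \<alpha> y | Some z \<Rightarrow> \<alpha> y \<oplus> z))"
  by standard (auto simp: fun_eq_iff commute left_commute split: option.split)

lemma combine_singleton [simp]: "combine \<alpha> {y} = \<alpha> y"
proof -
  interpret comp_fun_commute
    "\<lambda>y c. Some (case c of None \<Rightarrow> \<alpha> y | Some z \<Rightarrow> \<alpha> y \<oplus> z)"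
    by (rule combine_fold_commute)
  show ?thesis by (simp add: combine_def)
qed

lemma combine_insert [simp]:
  assumes "finite Y" "Y \<noteq> {}" "x \<notin> Y"
  shows "combine \<alpha> (insert x Y) = \<alpha> x \<oplus> combine \<alpha> Y"
proof -
  interpret comp_fun_commute
    "\<lambda>y c. Some (case c of None \<Rightarrow> \<alpha> y | Some z \<Rightarrow> \<alpha> y \<oplus> z)"
    by (rule combine_fold_commute)
  from assms(2) obtain y where "y \<in> Y" by blast
  then obtain Z where Z: "Y = insert y Z" "y \<notin> Z" by (rule Set.set_insert)
  with assms(1) have "finite Z" by simp
  with Z assms(3) show ?thesis by (simp add: combine_def)
qed

definition hierarchical_models :: "'v set list set" where
  "hierarchical_models = {\<pi>. \<pi> \<noteq> [] \<and> (\<forall>Y\<in>set \<pi>. Y \<noteq> {} \<and> Y \<subseteq> V)}"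

definition strictly_preferred :: "'v set list \<Rightarrow> ('v \<Rightarrow> 'a) \<Rightarrow> ('v \<Rightarrow> 'a) \<Rightarrow> bool" where
  "strictly_preferred \<pi> \<alpha> \<beta> \<longleftrightarrow>
     (\<exists>i<length \<pi>. combine \<alpha> (\<pi> ! i) > combine \<beta> (\<pi> ! i) \<and>
        (\<forall>j<i. combine \<alpha> (\<pi> ! j) = combine \<beta> (\<pi> ! j)))"

definition weakly_preferred :: "'v set list \<Rightarrow> ('v \<Rightarrow> 'a) \<Rightarrow> ('v \<Rightarrow> 'a) \<Rightarrow> bool" where
  "weakly_preferred \<pi> \<alpha> \<beta> \<longleftrightarrow>
     (\<forall>i<length \<pi>. combine \<alpha> (\<pi> ! i) = combine \<beta> (\<pi> ! i)) \<or> strictly_preferred \<pi> \<alpha> \<beta>"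

definition language :: "('v \<Rightarrow> 'a) pref_stmt set" where
  "language = {Geq \<alpha> \<beta> |\<alpha> \<beta>. \<alpha> \<in> alternatives \<and> \<beta> \<in> alternatives} \<union>
              {Gt \<alpha> \<beta> |\<alpha> \<beta>. \<alpha> \<in> alternatives \<and> \<beta> \<in> alternatives}"

fun sat :: "'v set list \<Rightarrow> ('v \<Rightarrow> 'a) pref_stmt \<Rightarrow> bool" where
  "sat \<pi> (Geq \<alpha> \<beta>) \<longleftrightarrow> weakly_preferred \<pi> \<alpha> \<beta>"
| "sat \<pi> (Gt \<alpha> \<beta>) \<longleftrightarrow> strictly_preferred \<pi> \<alpha> \<beta>"

definition models_of :: "('v \<Rightarrow> 'a) pref_stmt set \<Rightarrow> 'v set list set" where
  "models_of \<Phi> = {\<pi> \<in> hierarchical_models. \<forall>\<phi>\<in>\<Phi>. sat \<pi> \<phi>}"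

definition entails :: "('v \<Rightarrow> 'a) pref_stmt set \<Rightarrow> ('v \<Rightarrow> 'a) pref_stmt set \<Rightarrow> bool" where
  "entails \<Phi> \<Phi>' \<longleftrightarrow> (\<forall>\<pi>\<in>models_of \<Phi>. \<pi> \<in> models_of \<Phi>')"

definition equivalent :: "('v \<Rightarrow> 'a) pref_stmt set \<Rightarrow> ('v \<Rightarrow> 'a) pref_stmt set \<Rightarrow> bool" where
  "equivalent \<Phi> \<Phi>' \<longleftrightarrow> entails \<Phi> \<Phi>' \<and> entails \<Phi>' \<Phi>"

definition consistent :: "('v \<Rightarrow> 'a) pref_stmt set \<Rightarrow> bool" where
  "consistent \<Phi> \<longleftrightarrow> (\<exists>\<pi>. \<pi> \<in> models_of \<Phi>)"

definition falsifiable :: "('v \<Rightarrow> 'a) pref_stmt set \<Rightarrow> bool" where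
  "falsifiable \<Phi> \<longleftrightarrow> (\<exists>\<pi>\<in>hierarchical_models. \<pi> \<notin> models_of \<Phi>)"

definition nontrivial :: "('v \<Rightarrow> 'a) pref_stmt set \<Rightarrow> bool" where
  "nontrivial \<Phi> \<longleftrightarrow> consistent \<Phi> \<and> falsifiable \<Phi>"

definition middle_ground_candidate ::
  "nat \<Rightarrow> (nat \<Rightarrow> ('v \<Rightarrow> 'a) pref_stmt set) \<Rightarrow> ('v \<Rightarrow> 'a) pref_stmt set \<Rightarrow> bool" where
  "middle_ground_candidate n \<Psi> \<Phi> \<longleftrightarrow>
     nontrivial \<Phi> \<and>
     (consistent (\<Union>i\<in>{1..n}. \<Psi> i) \<longrightarrow> equivalent \<Phi> (\<Union>i\<in>{1..n}. \<Psi> i)) \<and>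
     (\<forall>\<phi>\<in>\<Phi>. \<forall>i\<in>{1..n}. \<forall>\<psi>\<in>\<Psi> i. \<exists>\<pi>\<in>hierarchical_models. sat \<pi> \<phi> \<and> sat \<pi> \<psi>) \<and>
     (\<forall>\<phi>\<in>\<Phi>. \<exists>i\<in>{1..n}. entails (\<Psi> i) {\<phi>})"

definition middle_ground ::
  "nat \<Rightarrow> (nat \<Rightarrow> ('v \<Rightarrow> 'a) pref_stmt set) \<Rightarrow> ('v \<Rightarrow> 'a) pref_stmt set \<Rightarrow> bool" where
  "middle_ground n \<Psi> \<Phi> \<longleftrightarrow>
     \<Phi> \<subseteq> language \<and> middle_ground_candidate n \<Psi> \<Phi> \<and>
     \<not> (\<exists>\<Phi>'. \<Phi>' \<subseteq> language \<and> middle_ground_candidate n \<Psi> \<Phi>' \<and> entails \<Phi>' \<Phi> \<and> \<not> entails \<Phi> \<Phi>')"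

end

end

theory Submission
  imports Defs
begin

text \<open>
  Take two variables with domain \<open>{0, 1}\<close> and ordinary addition. One stakeholder states
  \<open>00 \<ge> 10\<close> and the other \<open>00 \<ge> 01\<close>; since the reverse preferences always hold, each statement
  just forbids one of the variables, so it forces a model to look only at the other one.
  By (P3), a statement in a middle ground holds both in the model that looks only at the
  first variable and in the one that looks only at the second. But such a statement
  compares alternatives coordinatewise, so it holds in every model and is not falsifiable.
\<close>

text \<open>If the levels do not all tie, the first level that differs decides, and there the
  assumption turns the difference into a strict one in favour of \<open>\<alpha>\<close>.\<close>

lemma (in preference_setting) weakly_preferred_mono:
  assumes "\<forall>Y\<in>set \<pi>. combine \<beta> Y \<le> combine \<alpha> Y"
  shows "weakly_preferred \<pi> \<alpha> \<beta>"
proof (cases "\<forall>i<length \<pi>. combine \<alpha> (\<pi> ! i) = combine \<beta> (\<pi> ! i)")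
  case True
  then show ?thesis by (simp add: weakly_preferred_def)
next
  case False
  let ?P = "\<lambda>i. i < length \<pi> \<and> combine \<alpha> (\<pi> ! i) \<noteq> combine \<beta> (\<pi> ! i)"
  define i where "i = (LEAST i. ?P i)"
  from False have i: "?P i"
    unfolding i_def by (metis (mono_tags, lifting) LeastI_ex)
  have "combine \<alpha> (\<pi> ! j) = combine \<beta> (\<pi> ! j)" if "j < i" for j
    using not_less_Least[of j ?P] that i by (auto simp: i_def)
  moreover have "combine \<beta> (\<pi> ! i) < combine \<alpha> (\<pi> ! i)"
    using i assms by (metis nth_mem order.not_eq_order_implies_strict)
  ultimately show ?thesis
    using i by (auto simp: weakly_preferred_def strictly_preferred_def)
qed

text \<open>A strict preference would need a level where \<open>\<alpha>\<close> is strictly ahead,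
  which the assumption excludes; so only a tie at every level remains. This is how a weak statement
  can act as a prohibition.\<close>

lemma (in preference_setting) weakly_preferred_antimono:
  assumes "\<forall>Y\<in>set \<pi>. combine \<alpha> Y \<le> combine \<beta> Y"
  shows "weakly_preferred \<pi> \<alpha> \<beta> \<longleftrightarrow> (\<forall>Y\<in>set \<pi>. combine \<alpha> Y = combine \<beta> Y)"
proof -
  have "\<not> strictly_preferred \<pi> \<alpha> \<beta>"
    using assms by (auto simp: strictly_preferred_def not_less)
  then show ?thesis
    by (auto simp: weakly_preferred_def all_set_conv_all_nth)
qed

lemma (in preference_setting) strictly_preferred_mono:
  assumes "\<forall>Y\<in>set \<pi>. combine \<beta> Y < combine \<alpha> Y" "\<pi> \<noteq> []"
  shows "strictly_preferred \<pi> \<alpha> \<beta>"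
  using assms by (auto simp: strictly_preferred_def intro!: exI[of _ 0])

lemma (in preference_setting) sat_singleton [simp]:
  "sat [{v}] (Geq \<alpha> \<beta>) \<longleftrightarrow> \<beta> v \<le> \<alpha> v"
  "sat [{v}] (Gt \<alpha> \<beta>) \<longleftrightarrow> \<beta> v < \<alpha> v"
  by (auto simp: weakly_preferred_def strictly_preferred_def)

text \<open>Copies of a level add nothing: they tie exactly when the first one ties, so the first
  one already gives the verdict.\<close>

lemma (in preference_setting) sat_replicate:
  assumes "sat \<pi> \<phi>" "\<pi> \<noteq> []" "\<forall>Y\<in>set \<pi>. Y = {v}"
  shows "sat [{v}] \<phi>"
proof -
  have nth: "\<pi> ! i = {v}" if "i < length \<pi>" for i
    using assms(3) that nth_mem by blast
  show ?thesis
  proof (cases \<phi>)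
    case (Geq \<alpha> \<beta>)
    with assms(1) nth nth[of 0] \<open>\<pi> \<noteq> []\<close> show ?thesis
      by (auto simp: weakly_preferred_def strictly_preferred_def)
  next
    case (Gt \<alpha> \<beta>)
    with assms(1) nth show ?thesis
      by (auto simp: strictly_preferred_def)
  qed
qed

text \<open>Keeps the variable set \<open>{0, 1}\<close> in the form in which the interpretation below is stated.\<close>
declare One_nat_def [simp del]

abbreviation binary :: "nat \<Rightarrow> real set" where
  "binary \<equiv> \<lambda>_. {0, 1}"

interpretation pair: preference_setting "(+)" "{0, 1}" binary
  by standard auto

text \<open>The restricted abstraction yields \<open>undefined\<close> outside {0, 1}, as membership
  in the extensional product \<open>alternatives\<close> demands.\<close>

definition zero_alt :: "nat \<Rightarrow> real" where
  "zero_alt = (\<lambda>v\<in>{0, 1}. 0)"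

definition unit_alt :: "nat \<Rightarrow> nat \<Rightarrow> real" where
  "unit_alt k = (\<lambda>v\<in>{0, 1}. if v = k then 1 else 0)"

lemma alts_in_alternatives: "zero_alt \<in> pair.alternatives" "unit_alt k \<in> pair.alternatives"
  by (auto simp: pair.alternatives_def zero_alt_def unit_alt_def)

lemma sets_in_model:
  assumes "\<pi> \<in> pair.hierarchical_models" "Y \<in> set \<pi>"
  shows "Y \<in> {{0}, {1}, {0, 1}}"
proof -
  have "Y \<in> Pow {0, 1}" "Y \<noteq> {}"
    using assms by (simp_all add: pair.hierarchical_models_def)
  then show ?thesis
    by (simp only: Pow_insert) blast
qed

lemma combine_pair: "pair.combine \<alpha> {0, 1} = \<alpha> 0 + \<alpha> 1"
  using pair.combine_insert[of "{1}" 0 \<alpha>] by simp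

lemma singleton_model: "v \<in> {0, 1} \<Longrightarrow> [{v}] \<in> pair.hierarchical_models"
  by (auto simp: pair.hierarchical_models_def)

text \<open>The zero alternative never beats the unit one, so weak preference means ties throughout.
  A set ties iff it omits \<open>k\<close>, and the only non-empty such set is
  \<open>{1 - k}\<close>; here \<open>1 - k\<close> swaps the two variables.\<close>

lemma sat_zero_unit_iff:
  assumes "\<pi> \<in> pair.hierarchical_models" "k \<in> {0, 1}"
  shows "pair.sat \<pi> (Geq zero_alt (unit_alt k)) \<longleftrightarrow> (\<forall>Y\<in>set \<pi>. Y = {1 - k})"
proof -
  have alts: "zero_alt 0 = 0" "zero_alt 1 = 0"
      "unit_alt j 0 = (if j = 0 then 1 else 0)" "unit_alt j 1 = (if j = 1 then 1 else 0)" for j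
    by (auto simp: zero_alt_def unit_alt_def)
  have k: "k = 0 \<or> k = 1"
    using assms(2) by simp
  have c: "pair.combine zero_alt Y \<le> pair.combine (unit_alt k) Y"
      "pair.combine zero_alt Y = pair.combine (unit_alt k) Y \<longleftrightarrow> Y = {1 - k}"
    if "Y \<in> set \<pi>" for Y
  proof -
    have Y: "Y = {0} \<or> Y = {1} \<or> Y = {0, 1}"
      using sets_in_model[OF assms(1) that] by blast
    show "pair.combine zero_alt Y \<le> pair.combine (unit_alt k) Y"
      using Y k by (elim disjE) (simp_all add: alts combine_pair del: pair.combine_insert)
    show "pair.combine zero_alt Y = pair.combine (unit_alt k) Y \<longleftrightarrow> Y = {1 - k}"
      using Y k by (elim disjE) (simp_all add: alts combine_pair del: pair.combine_insert)
  qed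
  then have "pair.sat \<pi> (Geq zero_alt (unit_alt k)) \<longleftrightarrow>
      (\<forall>Y\<in>set \<pi>. pair.combine zero_alt Y = pair.combine (unit_alt k) Y)"
    using pair.weakly_preferred_antimono[of \<pi> zero_alt "unit_alt k"]
    unfolding pair.sat.simps by blast
  with c(2) show ?thesis by blast
qed

text \<open>The two singleton models compare the alternatives in each coordinate. Addition preserves
  both weak and strict inequalities, so the comparison carries over to {0, 1} and hence to every
  level of any model.\<close>

lemma valid_if_sat_singletons:
  assumes "\<pi> \<in> pair.hierarchical_models" "pair.sat [{0}] \<phi>" "pair.sat [{1}] \<phi>"
  shows "pair.sat \<pi> \<phi>"
proof (cases \<phi>)
  case (Geq \<alpha> \<beta>)
  have "pair.combine \<beta> Y \<le> pair.combine \<alpha> Y" if "Y \<in> set \<pi>" for Y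
  proof -
    have "\<beta> 0 \<le> \<alpha> 0" "\<beta> 1 \<le> \<alpha> 1"
      using assms(2,3) unfolding Geq pair.sat_singleton .
    moreover have "Y = {0} \<or> Y = {1} \<or> Y = {0, 1}"
      using sets_in_model[OF assms(1) that] by blast
    ultimately show ?thesis
      by (elim disjE) (simp_all only: pair.combine_singleton combine_pair add_mono)
  qed
  then show ?thesis
    using pair.weakly_preferred_mono[of \<pi> \<beta> \<alpha>] unfolding Geq pair.sat.simps by blast
next
  case (Gt \<alpha> \<beta>)
  have "pair.combine \<beta> Y < pair.combine \<alpha> Y" if "Y \<in> set \<pi>" for Y
  proof -
    have "\<beta> 0 < \<alpha> 0" "\<beta> 1 < \<alpha> 1"
      using assms(2,3) unfolding Gt pair.sat_singleton .
    moreover have "Y = {0} \<or> Y = {1} \<or> Y = {0, 1}"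
      using sets_in_model[OF assms(1) that] by blast
    ultimately show ?thesis
      by (elim disjE) (simp_all only: pair.combine_singleton combine_pair add_strict_mono)
  qed
  moreover have "\<pi> \<noteq> []"
    using assms(1) by (simp add: pair.hierarchical_models_def)
  ultimately show ?thesis
    using pair.strictly_preferred_mono[of \<pi> \<beta> \<alpha>] unfolding Gt pair.sat.simps by blast
qed

text \<open>Stakeholders are numbered from 1 and variables from 0: stakeholder \<open>i\<close>
  forbids variable \<open>i - 1\<close>, which leaves variable \<open>2 - i\<close>.\<close>

definition stakeholder :: "nat \<Rightarrow> (nat \<Rightarrow> real) pref_stmt set" where
  "stakeholder i = {Geq zero_alt (unit_alt (i - 1))}"

lemma stakeholder_language: "stakeholder i \<subseteq> pair.language"
  using alts_in_alternatives by (auto simp: stakeholder_def pair.language_def)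

lemma models_stakeholder:
  assumes "i \<in> {1..2}"
  shows "\<pi> \<in> pair.models_of (stakeholder i) \<longleftrightarrow>
    \<pi> \<in> pair.hierarchical_models \<and> (\<forall>Y\<in>set \<pi>. Y = {2 - i})"
proof -
  have "i - 1 \<in> {0, 1}" "1 - (i - 1) = 2 - i"
    using assms by auto
  then show ?thesis
    using sat_zero_unit_iff[of \<pi> "i - 1"] by (auto simp: pair.models_of_def stakeholder_def)
qed

lemma stakeholder_nontrivial:
  assumes "i \<in> {1..2}"
  shows "pair.nontrivial (stakeholder i)"
proof -
  have "2 - i \<in> {0, 1}" "i - 1 \<in> {0, 1}" "i - 1 \<noteq> 2 - i"
    using assms by (auto, presburger)
  \<comment> \<open>Looking only at the permitted variable gives consistency; looking only at the
    forbidden one falsifies the statement.\<close>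
  then have "[{2 - i}] \<in> pair.models_of (stakeholder i)"
      "[{i - 1}] \<in> pair.hierarchical_models" "[{i - 1}] \<notin> pair.models_of (stakeholder i)"
    using models_stakeholder[OF assms] singleton_model by auto
  then show ?thesis
    unfolding pair.nontrivial_def pair.consistent_def pair.falsifiable_def by blast
qed

lemma no_candidate: "\<not> pair.middle_ground_candidate 2 stakeholder \<Phi>"
proof
  assume cand: "pair.middle_ground_candidate 2 stakeholder \<Phi>"
  \<comment> \<open>Falsifiability of \<open>\<Phi>\<close> supplies a single statement that fails
    in some model; it will turn out to be valid.\<close>
  then obtain \<pi> \<phi> where \<pi>: "\<pi> \<in> pair.hierarchical_models" "\<phi> \<in> \<Phi>" "\<not> pair.sat \<pi> \<phi>"
    by (auto simp: pair.middle_ground_candidate_def pair.nontrivial_def pair.falsifiable_def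
        pair.models_of_def)
  have "pair.sat [{2 - i}] \<phi>" if i: "i \<in> {1..2}" for i
  proof -
    from cand \<pi>(2) i have
      "\<exists>\<rho>\<in>pair.hierarchical_models. pair.sat \<rho> \<phi> \<and> pair.sat \<rho> (Geq zero_alt (unit_alt (i - 1)))"
      unfolding pair.middle_ground_candidate_def stakeholder_def by blast
    \<comment> \<open>Since stakeholder \<open>i\<close> makes just one statement, the common model
      from (P3) is a model of the whole set \<open>stakeholder i\<close>, so all its levels are
      \<open>{2 - i}\<close>.\<close>
    then obtain \<rho> where \<rho>: "\<rho> \<in> pair.hierarchical_models" "pair.sat \<rho> \<phi>"
      "\<rho> \<in> pair.models_of (stakeholder i)"
      unfolding pair.models_of_def stakeholder_def by blast
    then have "\<rho> \<noteq> []" "\<forall>Y\<in>set \<rho>. Y = {2 - i}"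
      using models_stakeholder[OF i] by (simp_all add: pair.hierarchical_models_def)
    with \<rho>(2) show ?thesis
      by (rule pair.sat_replicate)
  qed
  from this[of 1] this[of 2] have "pair.sat [{1}] \<phi>" "pair.sat [{0}] \<phi>"
    by (simp_all add: One_nat_def)
  then show False
    using valid_if_sat_singletons[OF \<pi>(1)] \<pi>(3) by blast
qed

theorem theorem7:
  "\<exists>(oplus :: real \<Rightarrow> real \<Rightarrow> real) (V :: nat set) (D :: nat \<Rightarrow> real set)
     (n :: nat) (\<Psi> :: nat \<Rightarrow> (nat \<Rightarrow> real) pref_stmt set).
     preference_setting oplus V D \<and> n \<ge> 1 \<and>
     (\<forall>i\<in>{1..n}. \<Psi> i \<subseteq> preference_setting.language V D \<and>
                 preference_setting.nontrivial oplus V (\<Psi> i)) \<and>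
     \<not> (\<exists>\<Phi>. preference_setting.middle_ground oplus V D n \<Psi> \<Phi>)"
proof (intro exI conjI)
  show "preference_setting (+) {0, 1} binary"
    by (rule pair.preference_setting_axioms)
  show "(2::nat) \<ge> 1"
    by simp
  show "\<forall>i\<in>{1..2}. stakeholder i \<subseteq> pair.language \<and> pair.nontrivial (stakeholder i)"
    using stakeholder_language stakeholder_nontrivial by blast
  show "\<not> (\<exists>\<Phi>. pair.middle_ground 2 stakeholder \<Phi>)"
    using no_candidate by (simp add: pair.middle_ground_def)
qed

end
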